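(* Let $(S,\cdot,\leq)$ be an ordered semigroup. The following conditions are equivalent: (1) $S$ is an inverse ordered semigroup; (2) $S$ is regular and any two ordered idempotents of $S$ are $\mathcal{H}$-commutative, i.e. for all $e,f\in E_\leq(S)$ there is $x\in S$ with $ef\leq fxe$; (3) for all $e,f\in E_\leq(S)$, $e\,\mathcal{L}\,f$ implies $e\,\mathcal{H}\,f$, and $e\,\mathcal{R}\,f$ implies $e\,\mathcal{H}\,f$.
   Context: An ordered semigroup $(S,\cdot,\leq)$ is a semigroup with a partial order such that $a\leq b$ implies $xa\leq xb$ and $ax\leq bx$ for all $a,b,x\in S$. For $H\subseteq S$, $(H]=\{t\in S: t\leq h \text{ for some } h\in H\}$. $S$ is regular if $a\in(aSa]$ for every $a\in S$. The principal left and right ideals generated by $a\in S$ are $L(a)=(S^1a]$ and $R(a)=(aS^1]$, where $S^1a=\{a\}\cup Sa$ and $aS^1=\{a\}\cup aS$. Green's relations: $a\,\mathcal{L}\,b$ iff $L(a)=L(b)$; $a\,\mathcal{R}\,b$ iff $R(a)=R(b)$; $\mathcal{H}=\mathcal{L}\cap\mathcal{R}$. An ordered idempotent is an element $e\in S$ with $e\leq e^2$; $E_\leq(S)$ is the set of ordered idempotents of $S$. An element $b\in S$ is an inverse of $a\in S$ if $a\leq aba$ and $b\leq bab$; $V_\leq(a)$ is the set of inverses of $a$. An ordered semigroup $S$ is called inverse if it is regular and for every $a\in S$ any two elements of $V_\leq(a)$ are $\mathcal{H}$-related. Elements $a,b\in S$ are $\mathcal{H}$-commutative if $ab\leq bxa$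 for some $x\in S$.
   Formalization: Condition (3) is taken together with "S is regular", as in (2); without it the equivalence fails: the positive integers under addition, ordered by equality, have no ordered idempotents, so (3) holds vacuously, but S is not regular. *)

theory Defs
  imports Main
begin

locale ordered_semigroup =
  fixes S :: "'a set"
    and mult :: "'a \<Rightarrow> 'a \<Rightarrow> 'a" (infixl \<open>\<cdot>\<close> 70)
    and le :: "'a \<Rightarrow> 'a \<Rightarrow> bool" (infix \<open>\<sqsubseteq>\<close> 50)
  assumes mult_closed: "\<lbrakk>a \<in> S; b \<in> S\<rbrakk> \<Longrightarrow> a \<cdot> b \<in> S"
    and mult_assoc: "\<lbrakk>a \<in> S; b \<in> S; c \<in> S\<rbrakk> \<Longrightarrow> (a \<cdot> b) \<cdot> c = a \<cdot> (b \<cdot> c)"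
    and le_refl: "reflp_on S (\<sqsubseteq>)"
    and le_trans: "transp_on S (\<sqsubseteq>)"
    and le_antisym: "antisymp_on S (\<sqsubseteq>)"
    and mult_left_mono: "\<lbrakk>a \<in> S; b \<in> S; x \<in> S; a \<sqsubseteq> b\<rbrakk> \<Longrightarrow> x \<cdot> a \<sqsubseteq> x \<cdot> b"
    and mult_right_mono: "\<lbrakk>a \<in> S; b \<in> S; x \<in> S; a \<sqsubseteq> b\<rbrakk> \<Longrightarrow> a \<cdot> x \<sqsubseteq> b \<cdot> x"
begin

definition down_closure :: "'a set \<Rightarrow> 'a set" where
  "down_closure H = {t \<in> S. \<exists>h\<in>H. t \<sqsubseteq> h}"

definition is_regular :: bool where
  "is_regular \<longleftrightarrow> (\<forall>a\<in>S. a \<in> down_closure {a \<cdot> s \<cdot> a | s. s \<in> S})"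

definition left_ideal :: "'a \<Rightarrow> 'a set" where
  "left_ideal a = down_closure ({a} \<union> {s \<cdot> a | s. s \<in> S})"

definition right_ideal :: "'a \<Rightarrow> 'a set" where
  "right_ideal a = down_closure ({a} \<union> {a \<cdot> s | s. s \<in> S})"

definition green_L :: "'a \<Rightarrow> 'a \<Rightarrow> bool" where
  "green_L a b \<longleftrightarrow> left_ideal a = left_ideal b"

definition green_R :: "'a \<Rightarrow> 'a \<Rightarrow> bool" where
  "green_R a b \<longleftrightarrow> right_ideal a = right_ideal b"

definition green_H :: "'a \<Rightarrow> 'a \<Rightarrow> bool" where
  "green_H a b \<longleftrightarrow> green_L a b \<and> green_R a b"

definition ordered_idempotents :: "'a set" where
  "ordered_idempotents = {e \<in> S. e \<sqsubseteq> e \<cdot> e}"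

definition inverses :: "'a \<Rightarrow> 'a set" where
  "inverses a = {b \<in> S. a \<sqsubseteq> a \<cdot> b \<cdot> a \<and> b \<sqsubseteq> b \<cdot> a \<cdot> b}"

definition is_inverse :: bool where
  "is_inverse \<longleftrightarrow> is_regular \<and> (\<forall>a\<in>S. \<forall>b\<in>inverses a. \<forall>c\<in>inverses a. green_H b c)"

definition H_commutative :: "'a \<Rightarrow> 'a \<Rightarrow> bool" where
  "H_commutative a b \<longleftrightarrow> (\<exists>x\<in>S. a \<cdot> b \<sqsubseteq> b \<cdot> x \<cdot> a)"

end

text \<open>
  The conditions ``\<open>\<L>\<close>-related (respectively \<open>\<R>\<close>-related) ordered idempotents are
  \<open>\<H>\<close>-related'' do not imply regularity: the positive integers under addition, ordered by
  equality, have no ordered idempotents at all.  Hence these conditions characterize inverse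
  ordered semigroups only together with regularity.
\<close>

lemma idempotent_conditions_do_not_imply_regular:
  fixes S :: "nat set"
  defines "S \<equiv> {n. 0 < n}"
  shows "ordered_semigroup S (+) (=)"
    and "\<not> ordered_semigroup.is_regular S (+) (=)"
    and "ordered_semigroup.ordered_idempotents S (+) (=) = {}"
proof -
  interpret ordered_semigroup S "(+)" "(=)"
    by unfold_locales (auto simp: S_def intro: reflp_onI transp_onI antisymp_onI)
  show "ordered_semigroup S (+) (=)" by unfold_locales
  show "\<not> is_regular"
  proof
    assume is_regular
    moreover have "1 \<in> S" by (simp add: S_def)
    ultimately have "1 \<in> down_closure {1 + s + 1 | s. s \<in> S}"
      unfolding is_regular_def by blast
    then show False by (auto simp: down_closure_def)
  qed
  show "ordered_idempotents = {}"
    unfolding ordered_idempotents_def by (auto simp: S_def)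
qed

end

theory Submission
  imports Defs
begin

text \<open>
  In a regular ordered semigroup \<open>a \<L> b\<close> means \<open>a \<le> s b\<close> and \<open>b \<le> t a\<close> for some \<open>s, t\<close> (dually
  for \<open>\<R>\<close>), so \<open>\<H>\<close>-relatedness is a matter of factoring elements through one another.

  If \<open>S\<close> is inverse and \<open>x\<close> is an inverse of \<open>e f\<close>, then \<open>g = f x e\<close> is an ordered idempotent having
  both \<open>g\<close> and \<open>e f\<close> as inverses; hence \<open>e f \<H> g\<close>, and \<open>e f \<le> (e f) g (e f)\<close> yields
  \<open>e f \<le> f z e\<close>. If \<open>e \<le> x f\<close> and \<open>f \<le> y e\<close>, then \<open>u = e x f\<close> is an ordered idempotent, and both
  \<open>u\<close> and \<open>v = f y e\<close> are inverses of \<open>u\<close>; hence \<open>v \<R> u\<close> and \<open>f \<le> v\<close> lies below \<open>e S\<close>.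

  Conversely, for inverses \<open>b, c\<close> of \<open>a\<close> the products \<open>a b, a c\<close> are \<open>\<R>\<close>-related ordered idempotents
  and \<open>b a, c a\<close> are \<open>\<L>\<close>-related ones. Either condition on ordered idempotents then allows \<open>c\<close> to be
  moved to the outside of \<open>b \<le> b a b\<close>, on each side.
\<close>

context ordered_semigroup
begin

section \<open>Order calculus on the carrier and left-right duality\<close>

lemma le_transD: "\<lbrakk>a \<sqsubseteq> b; b \<sqsubseteq> c; a \<in> S; b \<in> S; c \<in> S\<rbrakk> \<Longrightarrow> a \<sqsubseteq> c"
  using le_trans by (meson transp_onD)

lemma le_reflI: "a \<in> S \<Longrightarrow> a \<sqsubseteq> a"
  using le_refl by (meson reflp_onD)

lemma mult_mono: "\<lbrakk>a \<sqsubseteq> b; c \<sqsubseteq> d; a \<in> S; b \<in> S; c \<in> S; d \<in> S\<rbrakk> \<Longrightarrow> a \<cdot> c \<sqsubseteq> b \<cdot> d"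
  by (meson le_transD mult_closed mult_left_mono mult_right_mono)

lemma le_mult_split: "\<lbrakk>a \<sqsubseteq> b \<cdot> c; b \<sqsubseteq> b'; c \<sqsubseteq> c'; a \<in> S; b \<in> S; b' \<in> S; c \<in> S; c' \<in> S\<rbrakk> \<Longrightarrow> a \<sqsubseteq> b' \<cdot> c'"
  by (meson le_transD mult_closed mult_mono)

text \<open>Reversing the multiplication exchanges left and right. The \<open>_dual\<close> lemmas
  translate each notion of the opposite structure back, so that \<open>green_R\<close> versions of
  results can be read off from their \<open>green_L\<close> versions.\<close>

lemma dual: "ordered_semigroup S (\<lambda>a b. b \<cdot> a) (\<sqsubseteq>)"
  by unfold_locales
    (simp_all add: mult_closed mult_assoc le_refl le_trans le_antisym mult_left_mono mult_right_mono)

lemma green_L_dual: "ordered_semigroup.green_L S (\<lambda>a b. b \<cdot> a) (\<sqsubseteq>) = green_R"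
  by (intro ext) (simp add: ordered_semigroup.green_L_def[OF dual] ordered_semigroup.left_ideal_def[OF dual]
      ordered_semigroup.down_closure_def[OF dual] green_R_def right_ideal_def down_closure_def)

lemma green_R_dual: "ordered_semigroup.green_R S (\<lambda>a b. b \<cdot> a) (\<sqsubseteq>) = green_L"
  by (intro ext) (simp add: ordered_semigroup.green_R_def[OF dual] ordered_semigroup.right_ideal_def[OF dual]
      ordered_semigroup.down_closure_def[OF dual] green_L_def left_ideal_def down_closure_def)

lemma green_H_dual: "ordered_semigroup.green_H S (\<lambda>a b. b \<cdot> a) (\<sqsubseteq>) = green_H"
  by (intro ext) (auto simp: ordered_semigroup.green_H_def[OF dual] green_L_dual green_R_dual green_H_def)

lemma ordered_idempotents_dual:
  "ordered_semigroup.ordered_idempotents S (\<lambda>a b. b \<cdot> a) (\<sqsubseteq>) = ordered_idempotents"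
  by (simp add: ordered_semigroup.ordered_idempotents_def[OF dual] ordered_idempotents_def)

lemma is_regular_iff: "is_regular \<longleftrightarrow> (\<forall>a\<in>S. \<exists>s\<in>S. a \<sqsubseteq> a \<cdot> s \<cdot> a)"
  unfolding is_regular_def down_closure_def by blast

lemma is_regular_dual: "ordered_semigroup.is_regular S (\<lambda>a b. b \<cdot> a) (\<sqsubseteq>) = is_regular"
  by (simp add: ordered_semigroup.is_regular_iff[OF dual] is_regular_iff mult_assoc)

text \<open>Reversal turns \<open>(a \<cdot> b) \<cdot> a\<close> into
  \<open>a \<cdot> (b \<cdot> a)\<close>; associativity is available on the carrier only, hence the
  hypothesis.\<close>

lemma inverses_dual:
  "a \<in> S \<Longrightarrow> ordered_semigroup.inverses S (\<lambda>a b. b \<cdot> a) (\<sqsubseteq>) a = inverses a"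
  by (auto simp: ordered_semigroup.inverses_def[OF dual] inverses_def mult_assoc)

lemma is_inverse_dual: "ordered_semigroup.is_inverse S (\<lambda>a b. b \<cdot> a) (\<sqsubseteq>) = is_inverse"
  by (simp add: ordered_semigroup.is_inverse_def[OF dual] is_inverse_def is_regular_dual
      inverses_dual green_H_dual)

section \<open>Green's relations in a regular ordered semigroup\<close>

lemma left_ideal_regular:
  assumes is_regular "a \<in> S"
  shows "left_ideal a = {t \<in> S. \<exists>s\<in>S. t \<sqsubseteq> s \<cdot> a}"
proof -
  obtain s where s: "s \<in> S" "a \<sqsubseteq> a \<cdot> s \<cdot> a"
    using assms is_regular_iff by blast
  have "t \<sqsubseteq> (a \<cdot> s) \<cdot> a" if "t \<in> S" "t \<sqsubseteq> a" for t
    using that s assms(2) by (meson le_transD mult_closed)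
  then show ?thesis
    using s(1) assms(2) mult_closed unfolding left_ideal_def down_closure_def by blast
qed

text \<open>It suffices to compare generators: each lies in its own ideal by regularity, and
  composing the left factors carries one ideal into the other.\<close>

lemma green_L_iff:
  assumes reg: is_regular and ab: "a \<in> S" "b \<in> S"
  shows "green_L a b \<longleftrightarrow> (\<exists>s\<in>S. a \<sqsubseteq> s \<cdot> b) \<and> (\<exists>s\<in>S. b \<sqsubseteq> s \<cdot> a)"
proof -
  have self: "\<exists>s\<in>S. c \<sqsubseteq> s \<cdot> c" if "c \<in> S" for c
    using reg that mult_closed unfolding is_regular_iff by blast
  have trans: "\<exists>s\<in>S. t \<sqsubseteq> s \<cdot> d" if "t \<in> S" "c \<in> S" "d \<in> S" "s \<in> S" "t \<sqsubseteq> s \<cdot> c" "s' \<in> S" "c \<sqsubseteq> s' \<cdot> d"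
    for t c d s s'
  proof
    show "t \<sqsubseteq> (s \<cdot> s') \<cdot> d"
      using le_mult_split[OF that(5) le_reflI that(7)] that by (simp add: mult_closed mult_assoc)
  qed (use that mult_closed in blast)
  show ?thesis
    unfolding green_L_def left_ideal_regular[OF reg ab(1)] left_ideal_regular[OF reg ab(2)]
    using self[OF ab(1)] self[OF ab(2)] ab trans by blast
qed

lemma green_R_iff:
  assumes "is_regular" "a \<in> S" "b \<in> S"
  shows "green_R a b \<longleftrightarrow> (\<exists>s\<in>S. a \<sqsubseteq> b \<cdot> s) \<and> (\<exists>s\<in>S. b \<sqsubseteq> a \<cdot> s)"
  using ordered_semigroup.green_L_iff[OF dual] assms is_regular_dual green_L_dual by simp

section \<open>Inverses and ordered idempotents\<close>

lemma inverse_exists: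
  assumes is_regular "a \<in> S"
  obtains b where "b \<in> inverses a"
proof -
  obtain s where s: "s \<in> S" "a \<sqsubseteq> a \<cdot> s \<cdot> a"
    using assms is_regular_iff by blast
  note c = assms(2) s(1) mult_closed
  \<comment> \<open>The inverse will be \<open>s \<cdot> a \<cdot> s\<close>: two expansions of
    \<open>a\<close> by regularity turn sas into sasasas = (sas)a(sas).\<close>
  have sas: "s \<cdot> a \<cdot> s \<sqsubseteq> s \<cdot> (a \<cdot> s \<cdot> a) \<cdot> s"
    by (intro mult_left_mono mult_right_mono s c)
  moreover have "s \<cdot> (a \<cdot> s \<cdot> a) \<cdot> s \<sqsubseteq> s \<cdot> ((a \<cdot> s \<cdot> a) \<cdot> s \<cdot> a) \<cdot> s"
    by (intro mult_left_mono mult_right_mono s c)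
  ultimately have "s \<cdot> a \<cdot> s \<sqsubseteq> s \<cdot> ((a \<cdot> s \<cdot> a) \<cdot> s \<cdot> a) \<cdot> s"
    by (rule le_transD) (intro c)+
  moreover have "a \<sqsubseteq> (a \<cdot> s \<cdot> a) \<cdot> s \<cdot> a"
    by (rule le_transD[OF s(2)]) (intro mult_right_mono s c)+
  ultimately have "s \<cdot> a \<cdot> s \<in> inverses a"
    using c by (simp add: inverses_def mult_assoc)
  then show thesis by (rule that)
qed

lemma inverses_sym: "\<lbrakk>a \<in> S; b \<in> inverses a\<rbrakk> \<Longrightarrow> a \<in> inverses b"
  by (simp add: inverses_def)

text \<open>Multiply a \<le> aba on the right by b. Together with \<open>inverses_sym\<close> this
  also covers the product ba.\<close>

lemma mult_inverse_idempotent: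
  assumes "a \<in> S" "b \<in> inverses a"
  shows "a \<cdot> b \<in> ordered_idempotents"
proof -
  have b: "b \<in> S" "a \<sqsubseteq> a \<cdot> b \<cdot> a"
    using assms(2) by (auto simp: inverses_def)
  have "a \<cdot> b \<sqsubseteq> (a \<cdot> b \<cdot> a) \<cdot> b"
    by (intro mult_right_mono b assms mult_closed)
  then show ?thesis
    using assms(1) b by (simp add: ordered_idempotents_def mult_closed mult_assoc)
qed

text \<open>Makes an ordered idempotent comparable with all its other inverses: in an inverse
  ordered semigroup they are \<H>-related to it.\<close>

lemma idempotent_in_inverses_self:
  assumes "e \<in> ordered_idempotents"
  shows "e \<in> inverses e"
proof -
  have e: "e \<in> S" "e \<sqsubseteq> e \<cdot> e"
    using assms by (auto simp: ordered_idempotents_def)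
  show ?thesis
    using le_mult_split[OF e(2) e(2) le_reflI] e by (simp add: inverses_def mult_closed)
qed

section \<open>Ordered idempotents in an inverse ordered semigroup\<close>

lemma inverse_imp_H_commutative:
  assumes inv: is_inverse and e: "e \<in> ordered_idempotents" and f: "f \<in> ordered_idempotents"
  shows "H_commutative e f"
proof -
  have reg: is_regular
    using inv by (simp add: is_inverse_def)
  have eS: "e \<in> S" "e \<sqsubseteq> e \<cdot> e" and fS: "f \<in> S" "f \<sqsubseteq> f \<cdot> f"
    using e f by (auto simp: ordered_idempotents_def)
  obtain x where "x \<in> inverses (e \<cdot> f)"
    using inverse_exists[OF reg mult_closed[OF eS(1) fS(1)]] .
  then have x: "x \<in> S" "e \<cdot> f \<sqsubseteq> (e \<cdot> f) \<cdot> x \<cdot> (e \<cdot> f)" "x \<sqsubseteq> x \<cdot> (e \<cdot> f) \<cdot> x"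
    by (auto simp: inverses_def)
  note c = eS(1) fS(1) x(1) mult_closed
  have efS: "e \<cdot> f \<in> S"
    by (intro c)
  \<comment> \<open>Since \<open>g\<close> starts with \<open>f\<close> and ends with
    \<open>e\<close>, any product that starts and ends with \<open>g\<close> has the shape required
    by \<open>H_commutative\<close>.\<close>
  define g where "g = f \<cdot> x \<cdot> e"
  have g: "g \<in> S"
    unfolding g_def by (intro c)
  have ggef: "g \<sqsubseteq> g \<cdot> g"
  proof -
    have "f \<cdot> x \<cdot> e \<sqsubseteq> f \<cdot> (x \<cdot> (e \<cdot> f) \<cdot> x) \<cdot> e"
      by (intro mult_right_mono mult_left_mono x c)
    then show ?thesis
      using c by (simp add: g_def mult_assoc)
  qed
  \<comment> \<open>Doubling \<open>f\<close> before \<open>x\<close> and \<open>e\<close> after it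
    supplies the letters that complete \<open>x\<close> to \<open>g\<close>.\<close>
  have "(e \<cdot> f) \<cdot> x \<cdot> (e \<cdot> f) \<sqsubseteq> (e \<cdot> (f \<cdot> f)) \<cdot> x \<cdot> ((e \<cdot> e) \<cdot> f)"
    by (intro mult_mono eS fS le_reflI c)
  then have "e \<cdot> f \<sqsubseteq> (e \<cdot> (f \<cdot> f)) \<cdot> x \<cdot> ((e \<cdot> e) \<cdot> f)"
    by (rule le_transD[OF x(2)]) (intro c)+
  then have efg: "e \<cdot> f \<sqsubseteq> (e \<cdot> f) \<cdot> g \<cdot> (e \<cdot> f)"
    using c by (simp add: g_def mult_assoc)
  \<comment> \<open>Doubling the inner \<open>e\<close> and \<open>f\<close> creates the factor ef
    between the two copies of \<open>g\<close>.\<close>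
  have "f \<cdot> x \<cdot> e \<cdot> (f \<cdot> x \<cdot> e) \<sqsubseteq> f \<cdot> x \<cdot> (e \<cdot> e) \<cdot> ((f \<cdot> f) \<cdot> x \<cdot> e)"
    by (intro mult_mono eS fS le_reflI c)
  then have "g \<cdot> g \<sqsubseteq> g \<cdot> (e \<cdot> f) \<cdot> g"
    using c by (simp add: g_def mult_assoc)
  then have "g \<sqsubseteq> g \<cdot> (e \<cdot> f) \<cdot> g"
    by (rule le_transD[OF ggef]) (intro g c)+
  then have "e \<cdot> f \<in> inverses g"
    using efg c by (simp add: inverses_def)
  moreover have "g \<in> inverses g"
    using g ggef by (intro idempotent_in_inverses_self) (simp add: ordered_idempotents_def)
  ultimately have "green_H (e \<cdot> f) g"
    using inv g unfolding is_inverse_def by blast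
  then obtain s t where s: "s \<in> S" "e \<cdot> f \<sqsubseteq> s \<cdot> g" and t: "t \<in> S" "e \<cdot> f \<sqsubseteq> g \<cdot> t"
    using green_L_iff[OF reg efS g] green_R_iff[OF reg efS g] unfolding green_H_def by blast
  \<comment> \<open>The first ef is replaced through \<R> and the last through \<L>, which leaves
    \<open>g\<close> at both ends.\<close>
  have "(e \<cdot> f) \<cdot> g \<cdot> (e \<cdot> f) \<sqsubseteq> (g \<cdot> t) \<cdot> g \<cdot> (s \<cdot> g)"
    by (intro mult_mono s t g le_reflI c)
  then have "e \<cdot> f \<sqsubseteq> (g \<cdot> t) \<cdot> g \<cdot> (s \<cdot> g)"
    by (rule le_transD[OF efg]) (intro g s t c)+
  then have "e \<cdot> f \<sqsubseteq> f \<cdot> (x \<cdot> e \<cdot> t \<cdot> g \<cdot> s \<cdot> f \<cdot> x) \<cdot> e"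
    using g s(1) t(1) c by (simp add: g_def mult_assoc)
  moreover have "x \<cdot> e \<cdot> t \<cdot> g \<cdot> s \<cdot> f \<cdot> x \<in> S"
    by (intro c g s t)
  ultimately show ?thesis
    unfolding H_commutative_def by blast
qed

text \<open>Prefixing \<open>e\<close> costs nothing: e \<le> ee \<le> e(xf).\<close>

lemma idempotent_le_conjugate:
  assumes e: "e \<in> ordered_idempotents" and "f \<in> S" "x \<in> S" "e \<sqsubseteq> x \<cdot> f"
  shows "e \<sqsubseteq> e \<cdot> x \<cdot> f"
proof -
  have "e \<in> S" "e \<sqsubseteq> e \<cdot> e"
    using e by (auto simp: ordered_idempotents_def)
  then show ?thesis
    using le_mult_split[OF _ le_reflI assms(4)] assms mult_closed mult_assoc by metis
qed

text \<open>With u = exf and v = fye, the bounds e \<le> u and f \<le> v give f \<le> vu, hence f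
  \<le> fvu, and multiplying by ex on the left gives u \<le> uvu. Exchanging the roles of
  \<open>e\<close> and \<open>f\<close> gives v \<le> vuv, so u and v are mutually inverse.\<close>

lemma conjugates_regular:
  assumes e: "e \<in> ordered_idempotents" and f: "f \<in> ordered_idempotents"
    and x: "x \<in> S" "e \<sqsubseteq> x \<cdot> f" and y: "y \<in> S" "f \<sqsubseteq> y \<cdot> e"
  shows "e \<cdot> x \<cdot> f \<sqsubseteq> (e \<cdot> x \<cdot> f) \<cdot> (f \<cdot> y \<cdot> e) \<cdot> (e \<cdot> x \<cdot> f)"
proof -
  have eS: "e \<in> S" "e \<sqsubseteq> e \<cdot> e" and fS: "f \<in> S" "f \<sqsubseteq> f \<cdot> f"
    using e f by (auto simp: ordered_idempotents_def)
  note c = eS(1) fS(1) x(1) y(1) mult_closed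
  have eu: "e \<sqsubseteq> e \<cdot> x \<cdot> f" and fv: "f \<sqsubseteq> f \<cdot> y \<cdot> e"
    using idempotent_le_conjugate e f x y eS fS by blast+
  have "f \<cdot> y \<cdot> e \<sqsubseteq> f \<cdot> y \<cdot> (e \<cdot> e)"
    by (intro mult_left_mono eS c)
  moreover have "f \<cdot> y \<cdot> (e \<cdot> e) \<sqsubseteq> f \<cdot> y \<cdot> (e \<cdot> (e \<cdot> x \<cdot> f))"
    by (intro mult_left_mono eu c)
  ultimately have "f \<cdot> y \<cdot> e \<sqsubseteq> f \<cdot> y \<cdot> (e \<cdot> (e \<cdot> x \<cdot> f))"
    by (rule le_transD) (intro c)+
  then have "f \<sqsubseteq> f \<cdot> y \<cdot> (e \<cdot> (e \<cdot> x \<cdot> f))"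
    by (rule le_transD[OF fv]) (intro c)+
  then have "f \<sqsubseteq> f \<cdot> (f \<cdot> y \<cdot> (e \<cdot> (e \<cdot> x \<cdot> f)))"
    by (rule le_mult_split[OF fS(2) le_reflI[OF fS(1)]]) (intro c)+
  then have "e \<cdot> x \<cdot> f \<sqsubseteq> e \<cdot> x \<cdot> (f \<cdot> (f \<cdot> y \<cdot> (e \<cdot> (e \<cdot> x \<cdot> f))))"
    by (intro mult_left_mono c)
  then show ?thesis
    using c by (simp add: mult_assoc)
qed

text \<open>This is one half of \<open>green_R e f\<close>; the other half comes from exchanging
  \<open>e\<close> and \<open>f\<close>.\<close>

lemma inverse_green_L_imp_le_right_multiple:
  assumes inv: is_inverse and e: "e \<in> ordered_idempotents" and f: "f \<in> ordered_idempotents"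
    and L: "green_L e f"
  shows "\<exists>s\<in>S. f \<sqsubseteq> e \<cdot> s"
proof -
  have reg: is_regular
    using inv by (simp add: is_inverse_def)
  have eS: "e \<in> S" "e \<sqsubseteq> e \<cdot> e" and fS: "f \<in> S"
    using e f by (auto simp: ordered_idempotents_def)
  obtain x y where x: "x \<in> S" "e \<sqsubseteq> x \<cdot> f" and y: "y \<in> S" "f \<sqsubseteq> y \<cdot> e"
    using L green_L_iff[OF reg eS(1) fS] by blast
  define u v where "u = e \<cdot> x \<cdot> f" and "v = f \<cdot> y \<cdot> e"
  note c = eS(1) fS x(1) y(1) mult_closed
  have uS: "u \<in> S" and vS: "v \<in> S"
    unfolding u_def v_def by (intro c)+
  have eu: "e \<sqsubseteq> u" and fv: "f \<sqsubseteq> v"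
    unfolding u_def v_def using idempotent_le_conjugate e f x y eS fS by blast+
  \<comment> \<open>Idempotency of \<open>u\<close> comes from u \<le> eu, where the prefix
    \<open>e\<close> is then enlarged to \<open>u\<close>.\<close>
  have "e \<cdot> (x \<cdot> f) \<sqsubseteq> (e \<cdot> e) \<cdot> (x \<cdot> f)"
    by (intro mult_right_mono eS c)
  then have "u \<sqsubseteq> e \<cdot> u"
    using c by (simp add: u_def mult_assoc)
  then have "u \<sqsubseteq> u \<cdot> u"
    using le_mult_split[OF _ eu le_reflI] uS eS by blast
  then have "u \<in> inverses u"
    using uS by (intro idempotent_in_inverses_self) (simp add: ordered_idempotents_def)
  moreover have "v \<in> inverses u"
    using conjugates_regular[OF e f x y] conjugates_regular[OF f e y x] vS
    by (simp add: inverses_def u_def v_def)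
  ultimately have "green_R v u"
    using inv uS unfolding is_inverse_def green_H_def by blast
  then obtain s where s: "s \<in> S" "v \<sqsubseteq> u \<cdot> s"
    using green_R_iff[OF reg vS uS] by blast
  have "f \<sqsubseteq> u \<cdot> s"
    by (rule le_transD[OF fv s(2)]) (intro fS vS uS s mult_closed)+
  then have "f \<sqsubseteq> e \<cdot> (x \<cdot> f \<cdot> s)"
    using c s(1) by (simp add: u_def mult_assoc)
  then show ?thesis
    by (rule bexI) (intro c s)
qed

lemma inverse_green_L_imp_green_H:
  assumes inv: is_inverse and ef: "e \<in> ordered_idempotents" "f \<in> ordered_idempotents"
    and L: "green_L e f"
  shows "green_H e f"
proof -
  have "green_R e f \<longleftrightarrow> (\<exists>s\<in>S. e \<sqsubseteq> f \<cdot> s) \<and> (\<exists>s\<in>S. f \<sqsubseteq> e \<cdot> s)"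
    using inv ef by (intro green_R_iff) (auto simp: is_inverse_def ordered_idempotents_def)
  moreover have "green_L f e"
    using L by (simp add: green_L_def)
  ultimately show ?thesis
    using inverse_green_L_imp_le_right_multiple inv ef L unfolding green_H_def by blast
qed

lemma inverse_green_R_imp_green_H:
  assumes "is_inverse" "e \<in> ordered_idempotents" "f \<in> ordered_idempotents" "green_R e f"
  shows "green_H e f"
  using ordered_semigroup.inverse_green_L_imp_green_H[OF dual] assms
  by (simp add: is_inverse_dual ordered_idempotents_dual green_L_dual green_H_dual)

section \<open>From conditions on ordered idempotents to \<H>-related inverses\<close>

lemma is_inverseI:
  assumes reg: is_regular
    and L: "\<And>a b c. \<lbrakk>a \<in> S; b \<in> inverses a; c \<in> inverses a\<rbrakk> \<Longrightarrow> \<exists>s\<in>S. b \<sqsubseteq> s \<cdot> c"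
    and R: "\<And>a b c. \<lbrakk>a \<in> S; b \<in> inverses a; c \<in> inverses a\<rbrakk> \<Longrightarrow> \<exists>s\<in>S. b \<sqsubseteq> c \<cdot> s"
  shows is_inverse
  unfolding is_inverse_def
proof (intro conjI ballI reg)
  fix a b c
  assume *: "a \<in> S" "b \<in> inverses a" "c \<in> inverses a"
  then have "b \<in> S" "c \<in> S"
    by (auto simp: inverses_def)
  \<comment> \<open>As \<open>b\<close> and \<open>c\<close> may be exchanged in \<open>L\<close>
    and \<open>R\<close>, one inequality on each side yields both.\<close>
  then show "green_H b c"
    using * L R by (auto simp: green_H_def green_L_iff[OF reg] green_R_iff[OF reg])
qed

text \<open>The bound b \<le> bacab can be bracketed as b((ac)(ab)) or as ((ba)(ca))b. Commuting the
  first pair moves c to the right end, commuting the second moves it to the left end.\<close>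

lemma H_commutative_imp_inverse:
  assumes reg: is_regular
    and H: "\<And>e f. \<lbrakk>e \<in> ordered_idempotents; f \<in> ordered_idempotents\<rbrakk> \<Longrightarrow> H_commutative e f"
  shows is_inverse
proof (rule is_inverseI[OF reg])
  fix a b c
  assume a: "a \<in> S" and bV: "b \<in> inverses a" and cV: "c \<in> inverses a"
  have b: "b \<in> S" "b \<sqsubseteq> b \<cdot> a \<cdot> b" and c: "c \<in> S" "a \<sqsubseteq> a \<cdot> c \<cdot> a"
    using bV cV by (auto simp: inverses_def)
  note cl = a b(1) c(1) mult_closed
  have "b \<cdot> a \<cdot> b \<sqsubseteq> b \<cdot> (a \<cdot> c \<cdot> a) \<cdot> b"
    by (intro mult_left_mono mult_right_mono c cl)
  then have bacab: "b \<sqsubseteq> b \<cdot> (a \<cdot> c \<cdot> a) \<cdot> b"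
    by (rule le_transD[OF b(2)]) (intro cl)+
  note idem = mult_inverse_idempotent[OF a bV] mult_inverse_idempotent[OF a cV]
    mult_inverse_idempotent[OF b(1) inverses_sym[OF a bV]]
    mult_inverse_idempotent[OF c(1) inverses_sym[OF a cV]]
  obtain x where x: "x \<in> S" "(a \<cdot> c) \<cdot> (a \<cdot> b) \<sqsubseteq> (a \<cdot> b) \<cdot> x \<cdot> (a \<cdot> c)"
    using H[OF idem(2,1)] unfolding H_commutative_def by blast
  have "b \<sqsubseteq> b \<cdot> ((a \<cdot> c) \<cdot> (a \<cdot> b))"
    using bacab cl by (simp add: mult_assoc)
  moreover have "b \<cdot> ((a \<cdot> c) \<cdot> (a \<cdot> b)) \<sqsubseteq> b \<cdot> ((a \<cdot> b) \<cdot> x \<cdot> (a \<cdot> c))"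
    by (intro mult_left_mono x cl)
  ultimately have "b \<sqsubseteq> b \<cdot> ((a \<cdot> b) \<cdot> x \<cdot> (a \<cdot> c))"
    by (rule le_transD) (intro x cl)+
  then have "b \<sqsubseteq> (b \<cdot> a \<cdot> b \<cdot> x \<cdot> a) \<cdot> c"
    using x(1) cl by (simp add: mult_assoc)
  then show "\<exists>s\<in>S. b \<sqsubseteq> s \<cdot> c"
    by (rule bexI) (intro x cl)
  obtain y where y: "y \<in> S" "(b \<cdot> a) \<cdot> (c \<cdot> a) \<sqsubseteq> (c \<cdot> a) \<cdot> y \<cdot> (b \<cdot> a)"
    using H[OF idem(3,4)] unfolding H_commutative_def by blast
  have "b \<sqsubseteq> ((b \<cdot> a) \<cdot> (c \<cdot> a)) \<cdot> b"
    using bacab cl by (simp add: mult_assoc)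
  moreover have "((b \<cdot> a) \<cdot> (c \<cdot> a)) \<cdot> b \<sqsubseteq> ((c \<cdot> a) \<cdot> y \<cdot> (b \<cdot> a)) \<cdot> b"
    by (intro mult_right_mono y cl)
  ultimately have "b \<sqsubseteq> ((c \<cdot> a) \<cdot> y \<cdot> (b \<cdot> a)) \<cdot> b"
    by (rule le_transD) (intro y cl)+
  then have "b \<sqsubseteq> c \<cdot> (a \<cdot> y \<cdot> b \<cdot> a \<cdot> b)"
    using y(1) cl by (simp add: mult_assoc)
  then show "\<exists>s\<in>S. b \<sqsubseteq> c \<cdot> s"
    by (rule bexI) (intro y cl)
qed

text \<open>The hypothesis upgrades \<L> to \<R> for ba and ca; then ba \<le> cas, and b \<le> (ba)b
  puts b below a right multiple of c.\<close>

lemma green_L_imp_inverses_le_right_multiple: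
  assumes reg: is_regular
    and H: "\<And>e f. \<lbrakk>e \<in> ordered_idempotents; f \<in> ordered_idempotents; green_L e f\<rbrakk> \<Longrightarrow> green_H e f"
    and a: "a \<in> S" and bV: "b \<in> inverses a" and cV: "c \<in> inverses a"
  shows "\<exists>s\<in>S. b \<sqsubseteq> c \<cdot> s"
proof -
  have b: "b \<in> S" "b \<sqsubseteq> b \<cdot> a \<cdot> b" "a \<sqsubseteq> a \<cdot> b \<cdot> a" and c: "c \<in> S" "a \<sqsubseteq> a \<cdot> c \<cdot> a"
    using bV cV by (auto simp: inverses_def)
  note cl = a b(1) c(1) mult_closed
  have "b \<cdot> a \<sqsubseteq> b \<cdot> (a \<cdot> c \<cdot> a)" "c \<cdot> a \<sqsubseteq> c \<cdot> (a \<cdot> b \<cdot> a)"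
    by (intro mult_left_mono b c cl)+
  then have "b \<cdot> a \<sqsubseteq> (b \<cdot> a) \<cdot> (c \<cdot> a)" "c \<cdot> a \<sqsubseteq> (c \<cdot> a) \<cdot> (b \<cdot> a)"
    using cl by (simp_all add: mult_assoc)
  moreover have baS: "b \<cdot> a \<in> S" and caS: "c \<cdot> a \<in> S"
    by (intro cl)+
  ultimately have "green_L (b \<cdot> a) (c \<cdot> a)"
    using green_L_iff[OF reg baS caS] by blast
  then have "green_H (b \<cdot> a) (c \<cdot> a)"
    using H mult_inverse_idempotent inverses_sym a b(1) bV c(1) cV by blast
  then obtain s where s: "s \<in> S" "b \<cdot> a \<sqsubseteq> c \<cdot> a \<cdot> s"
    using green_R_iff[OF reg baS caS] unfolding green_H_def by blast
  have "b \<sqsubseteq> (c \<cdot> a \<cdot> s) \<cdot> b"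
    by (rule le_mult_split[OF b(2) s(2) le_reflI]) (intro s cl)+
  then have "b \<sqsubseteq> c \<cdot> (a \<cdot> s \<cdot> b)"
    using s(1) cl by (simp add: mult_assoc)
  then show ?thesis
    by (rule bexI) (intro s cl)
qed

lemma green_R_imp_inverses_le_left_multiple:
  assumes reg: is_regular
    and H: "\<And>e f. \<lbrakk>e \<in> ordered_idempotents; f \<in> ordered_idempotents; green_R e f\<rbrakk> \<Longrightarrow> green_H e f"
    and a: "a \<in> S" and bV: "b \<in> inverses a" and cV: "c \<in> inverses a"
  shows "\<exists>s\<in>S. b \<sqsubseteq> s \<cdot> c"
  by (rule ordered_semigroup.green_L_imp_inverses_le_right_multiple[OF dual, of a])
    (simp_all add: assms is_regular_dual ordered_idempotents_dual green_L_dual green_H_dual inverses_dual)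

section \<open>The two characterizations\<close>

theorem is_inverse_iff_H_commutative:
  "is_inverse \<longleftrightarrow>
    is_regular \<and> (\<forall>e\<in>ordered_idempotents. \<forall>f\<in>ordered_idempotents. H_commutative e f)"
  using inverse_imp_H_commutative H_commutative_imp_inverse is_inverse_def by blast

text \<open>Regularity has to be part of the right-hand side:
  \<open>idempotent_conditions_do_not_imply_regular\<close> gives a nonregular example in which the
  conditions on ordered idempotents hold vacuously.\<close>

theorem is_inverse_iff_green_H:
  "is_inverse \<longleftrightarrow>
    is_regular \<and> (\<forall>e\<in>ordered_idempotents. \<forall>f\<in>ordered_idempotents.
      (green_L e f \<longrightarrow> green_H e f) \<and> (green_R e f \<longrightarrow> green_H e f))"
proof
  assume is_inverse
  then show "is_regular \<and> (\<forall>e\<in>ordered_idempotents. \<forall>f\<in>ordered_idempotents.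
      (green_L e f \<longrightarrow> green_H e f) \<and> (green_R e f \<longrightarrow> green_H e f))"
    using inverse_green_L_imp_green_H inverse_green_R_imp_green_H is_inverse_def by blast
next
  assume *: "is_regular \<and> (\<forall>e\<in>ordered_idempotents. \<forall>f\<in>ordered_idempotents.
      (green_L e f \<longrightarrow> green_H e f) \<and> (green_R e f \<longrightarrow> green_H e f))"
  show is_inverse
  proof (rule is_inverseI)
    show is_regular
      using * by blast
    fix a b c
    assume "a \<in> S" "b \<in> inverses a" "c \<in> inverses a"
    then show "\<exists>s\<in>S. b \<sqsubseteq> s \<cdot> c" "\<exists>s\<in>S. b \<sqsubseteq> c \<cdot> s"
      using * green_R_imp_inverses_le_left_multiple[of a b c]
        green_L_imp_inverses_le_right_multiple[of a b c] by blast+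
  qed
qed

end

theorem theorem3p4:
  fixes S :: "'a set"
    and mult :: "'a \<Rightarrow> 'a \<Rightarrow> 'a"
    and le :: "'a \<Rightarrow> 'a \<Rightarrow> bool"
  assumes "ordered_semigroup S mult le"
  shows "(ordered_semigroup.is_inverse S mult le \<longleftrightarrow>
            ordered_semigroup.is_regular S mult le \<and>
            (\<forall>e\<in>ordered_semigroup.ordered_idempotents S mult le.
             \<forall>f\<in>ordered_semigroup.ordered_idempotents S mult le.
               ordered_semigroup.H_commutative S mult le e f))
       \<and> (ordered_semigroup.is_inverse S mult le \<longleftrightarrow>
            ordered_semigroup.is_regular S mult le \<and>
            (\<forall>e\<in>ordered_semigroup.ordered_idempotents S mult le.
             \<forall>f\<in>ordered_semigroup.ordered_idempotents S mult le.
               (ordered_semigroup.green_L S mult le e f \<longrightarrow> ordered_semigroup.green_H S mult le e f) \<and>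
               (ordered_semigroup.green_R S mult le e f \<longrightarrow> ordered_semigroup.green_H S mult le e f)))"
  using ordered_semigroup.is_inverse_iff_H_commutative[OF assms]
    ordered_semigroup.is_inverse_iff_green_H[OF assms] by (rule conjI)

end
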